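(* Let $(E,H,\mu)$ be an abstract Wiener space, let $x\in E\setminus H$, and let $E_x\subset E$ be the Borel linear subspace defined in the context. Define the equivalence relation $y\sim z$ on $E$ by $y\sim z$ if and only if $y-z\in E_x$, and let $\tau\subset E$ be a set containing exactly one representative of each equivalence class. Then $\tau$ is uncountable and $$E=\bigcup_{z\in\tau}(E_x+z)$$ is a disjoint union of Borel sets, each of which is invariant for the Brownian motion on $E$, i.e. $P_t(1_{E_x+z})=1_{E_x+z}$ for all $t>0$ and $z\in\tau$. Hence $E$ is an uncountable union of disjoint Borel sets which are invariant for the Brownian motion.
   Context: Abstract Wiener space $(E,H,\mu)$: $(H,\langle\cdot,\cdot\rangle)$ is a separable real Hilbert space with norm $|\cdot|$, continuously and densely embedded into a Banach space $(E,\|\cdot\|)$; identifying $H$ with its dual, $E'\subset H\subset E$ continuously and densely; and $\mu$ is a Gaussian probability measure on the Borel $\sigma$-algebra $\mathcal B$ of $E$ such that every $l\in E'$ is, under $\mu$, normally distributed with mean $0$ and variance $|l|^2$ (the $H$-norm of $l$). Write ${}_{E'}\langle l,z\rangle_E=l(z)$. For $t>0$, $\mu_t$ is the image of $\mu$ under $z\mapsto\sqrt t\,z$ and $P_tf(y)=\int_E f(y+w)\,\mu_t(dw)$; $(P_t)_{t\ge 0}$ is the transition function of the Brownian motion on $E$. Fix $x\in E\setminus H$ (so $\dim H=\infty$). Fix an orthonormal basis $\{e_n^x: n\ge1\}$ of $H$ with $e_n^x\in E'$ for all $n$, which separates the points of $E$ and satisfies ${}_{E'}\langle e_n^x,x\rangle_E\ge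 2^{n/2}$ for all $n$ (such a basis exists). Let $\widetilde P_n z=\sum_{k=1}^n {}_{E'}\langle e_k^x,z\rangle_E\,e_k^x$, $z\in E$. Let $(\widetilde Q_n)_{n\ge1}$ be a subsequence of $(\widetilde P_n)_{n\ge1}$, with $Q_n:=\widetilde Q_n|_H$, such that for all $n\ge1$ $$\|\mathrm{Id}_H-Q_n\|_{\mathcal L(H,E)}\le 2^{-n},\qquad \mu(\{z\in E:\|z-\widetilde Q_nz\|>2^{-n}\})\le 2^{-n}$$ (such a subsequence exists), and $\widetilde Q_0:=0$. Define $$q_x(z):=\Big[\sum_{n\ge0}2^n\|\widetilde Q_{n+1}z-\widetilde Q_nz\|^2+\Big(\sum_{n\ge1}2^{-n/2}|{}_{E'}\langle e_n^x,z\rangle_E|\Big)^2\Big]^{1/2},\quad z\in E,$$ and $E_x:=\{z\in E: q_x(z)<\infty\}$. *)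

theory Defs
  imports "HOL-Probability.Probability"
begin

(* The embedding of the Hilbert space H into the Banach space E is an explicit map
   \<iota> from type 'h to type 'e, so "z \<in> H" reads z \<in> range \<iota>. The dual E' is the type of
   bounded linear functionals 'e \<Rightarrow>\<^sub>L real, and the pairing of l and z is blinfun_apply l z. *)

section \<open>Abstract Wiener spaces\<close>

(* Identification of H with its dual: the element of H that represents the restriction
   of l to H. It is unique, and it exists by the Riesz representation theorem. *)
definition dual_to_H :: "('h::real_inner \<Rightarrow> 'e::real_normed_vector) \<Rightarrow> ('e \<Rightarrow>\<^sub>L real) \<Rightarrow> 'h" where
  "dual_to_H \<iota> l = (THE h. \<forall>k. blinfun_apply l (\<iota> k) = h \<bullet> k)"

(* The normal law with mean m and variance v; for v = 0 it is the point mass at m. *)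
definition normal_law :: "real \<Rightarrow> real \<Rightarrow> real measure" where
  "normal_law m v =
     (if v = 0 then return borel m else density lborel (\<lambda>s. ennreal (normal_density m (sqrt v) s)))"

(* The dense inclusion of E' in H is not assumed: E' is dense in H because
   \<iota> is injective, and E' embeds into H because range \<iota> is dense in E. *)
locale abstract_wiener_space = prob_space \<mu>
  for \<iota> :: "'h::{real_inner, complete_space} \<Rightarrow> 'e::banach" and \<mu> :: "'e measure" +
  assumes separable_H: "separable_space (euclidean :: 'h topology)"
    and continuous_embedding: "bounded_linear \<iota>"
    and inj_embedding: "inj \<iota>"
    and dense_embedding: "closure (range \<iota>) = UNIV"
    and sets_borel: "sets \<mu> = sets borel"
    and gaussian: "\<And>l :: 'e \<Rightarrow>\<^sub>L real.
      distr \<mu> borel (blinfun_apply l) = normal_law 0 ((norm (dual_to_H \<iota> l))\<^sup>2)"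

section \<open>Brownian motion on E\<close>

definition scaled_measure :: "'e::banach measure \<Rightarrow> real \<Rightarrow> 'e measure" where
  "scaled_measure \<mu> t = distr \<mu> borel (\<lambda>z. sqrt t *\<^sub>R z)"

definition brownian_transition :: "'e::banach measure \<Rightarrow> real \<Rightarrow> ('e \<Rightarrow> real) \<Rightarrow> 'e \<Rightarrow> real" where
  "brownian_transition \<mu> t f y = (\<integral>w. f (y + w) \<partial>scaled_measure \<mu> t)"

definition brownian_invariant :: "'e::banach measure \<Rightarrow> 'e set \<Rightarrow> bool" where
  "brownian_invariant \<mu> A \<longleftrightarrow>
     (\<forall>t>0. brownian_transition \<mu> t (indicat_real A) = indicat_real A)"

section \<open>The subspace attached to a point outside H\<close>

(* Sequences indexed by n \<ge> 1 are functions on nat whose value at 0 is never used. *)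

definition orthonormal_basis :: "(nat \<Rightarrow> 'h::real_inner) \<Rightarrow> bool" where
  "orthonormal_basis b \<longleftrightarrow>
     (\<forall>m\<ge>1. \<forall>n\<ge>1. b m \<bullet> b n = (if m = n then 1 else 0)) \<and> closure (span (b ` {1..})) = UNIV"

(* e n is an element of E'; as a vector of H it is dual_to_H \<iota> (e n). *)
definition adapted_basis ::
  "('h::real_inner \<Rightarrow> 'e::banach) \<Rightarrow> 'e \<Rightarrow> (nat \<Rightarrow> ('e \<Rightarrow>\<^sub>L real)) \<Rightarrow> bool" where
  "adapted_basis \<iota> x e \<longleftrightarrow>
     orthonormal_basis (\<lambda>n. dual_to_H \<iota> (e n)) \<and>
     (\<forall>y z. y \<noteq> z \<longrightarrow> (\<exists>n\<ge>1. blinfun_apply (e n) y \<noteq> blinfun_apply (e n) z)) \<and>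
     (\<forall>n\<ge>1. blinfun_apply (e n) x \<ge> 2 powr (real n / 2))"

definition P_tilde ::
  "('h::real_inner \<Rightarrow> 'e::banach) \<Rightarrow> (nat \<Rightarrow> ('e \<Rightarrow>\<^sub>L real)) \<Rightarrow> nat \<Rightarrow> 'e \<Rightarrow> 'e" where
  "P_tilde \<iota> e n z = (\<Sum>k=1..n. blinfun_apply (e k) z *\<^sub>R \<iota> (dual_to_H \<iota> (e k)))"

definition Q_tilde ::
  "('h::real_inner \<Rightarrow> 'e::banach) \<Rightarrow> (nat \<Rightarrow> ('e \<Rightarrow>\<^sub>L real)) \<Rightarrow> (nat \<Rightarrow> nat) \<Rightarrow> nat \<Rightarrow> 'e \<Rightarrow> 'e" where
  "Q_tilde \<iota> e \<sigma> n z = (if n = 0 then 0 else P_tilde \<iota> e (\<sigma> n) z)"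

(* Strict monotonicity at 0 only forces \<sigma> n \<ge> 1 for n \<ge> 1. The operator norm is that of
   the map from H to E. *)
definition adapted_subsequence ::
  "('h::real_inner \<Rightarrow> 'e::banach) \<Rightarrow> 'e measure \<Rightarrow> (nat \<Rightarrow> ('e \<Rightarrow>\<^sub>L real)) \<Rightarrow> (nat \<Rightarrow> nat) \<Rightarrow> bool" where
  "adapted_subsequence \<iota> \<mu> e \<sigma> \<longleftrightarrow>
     strict_mono \<sigma> \<and>
     (\<forall>n\<ge>1. onorm (\<lambda>h. \<iota> h - Q_tilde \<iota> e \<sigma> n (\<iota> h)) \<le> 1 / 2 ^ n) \<and>
     (\<forall>n\<ge>1. measure \<mu> {z. norm (z - Q_tilde \<iota> e \<sigma> n z) > 1 / 2 ^ n} \<le> 1 / 2 ^ n)"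

definition q_squared ::
  "('h::real_inner \<Rightarrow> 'e::banach) \<Rightarrow> (nat \<Rightarrow> ('e \<Rightarrow>\<^sub>L real)) \<Rightarrow> (nat \<Rightarrow> nat) \<Rightarrow> 'e \<Rightarrow> ennreal" where
  "q_squared \<iota> e \<sigma> z =
     (\<Sum>n. ennreal (2 ^ n * (norm (Q_tilde \<iota> e \<sigma> (Suc n) z - Q_tilde \<iota> e \<sigma> n z))\<^sup>2)) +
     (\<Sum>n. ennreal (2 powr (- real (Suc n) / 2) * \<bar>blinfun_apply (e (Suc n)) z\<bar>))\<^sup>2"

(* The square root on [0,\<infinity>], which the library does not provide for ennreal. *)
definition q_norm ::
  "('h::real_inner \<Rightarrow> 'e::banach) \<Rightarrow> (nat \<Rightarrow> ('e \<Rightarrow>\<^sub>L real)) \<Rightarrow> (nat \<Rightarrow> nat) \<Rightarrow> 'e \<Rightarrow> ennreal" where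
  "q_norm \<iota> e \<sigma> z =
     (if q_squared \<iota> e \<sigma> z = \<infinity> then \<infinity> else ennreal (sqrt (enn2real (q_squared \<iota> e \<sigma> z))))"

definition E_sub ::
  "('h::real_inner \<Rightarrow> 'e::banach) \<Rightarrow> (nat \<Rightarrow> ('e \<Rightarrow>\<^sub>L real)) \<Rightarrow> (nat \<Rightarrow> nat) \<Rightarrow> 'e set" where
  "E_sub \<iota> e \<sigma> = {z. q_norm \<iota> e \<sigma> z < \<infinity>}"

definition diff_rel :: "'e::ab_group_add set \<Rightarrow> ('e \<times> 'e) set" where
  "diff_rel V = {(y, z). y - z \<in> V}"

definition translate :: "'e::ab_group_add set \<Rightarrow> 'e \<Rightarrow> 'e set" where
  "translate V z = (\<lambda>v. v + z) ` V"

definition class_representatives :: "('e \<times> 'e) set \<Rightarrow> 'e set \<Rightarrow> bool" where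
  "class_representatives R \<tau> \<longleftrightarrow> (\<forall>C \<in> UNIV // R. \<exists>!z. z \<in> \<tau> \<and> z \<in> C)"

end

theory Submission
  imports Defs
begin

text \<open>
  Every Borel subspace \<open>V\<close> of full measure is invariant: a point of \<open>V + z\<close> stays in \<open>V + z\<close> under an
  increment in \<open>V\<close>, a point outside stays outside, and almost every increment lies in \<open>V\<close>. If in
  addition \<open>x \<notin> V\<close>, then the points of the line through \<open>x\<close> lie in pairwise different cosets, so
  there are uncountably many. The space \<open>E\<^sub>x\<close> has full measure by Borel-Cantelli and because the
  \<open>e\<^sub>n\<close> are standard normal, and misses \<open>x\<close> because of the lower bounds on \<open>e\<^sub>n(x)\<close>.

  The last claim does not presuppose a basis, and for it a sequence in the dual suffices: there are
  \<open>l\<^sub>n\<close> of \<open>H\<close>-norm at most \<open>1\<close> with \<open>l\<^sub>n(x) \<ge> 2\<^sup>n\<close>, and then \<open>V = {z. \<Sum>n. 2\<^sup>-\<^sup>n \<bar>l\<^sub>n(z)\<bar> < \<infinity>}\<close>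
  works. They come from Hahn-Banach, applied to \<open>p(z) = inf\<^sub>h (\<bar>h\<bar> + b \<parallel>z - h\<parallel>)\<close> with large \<open>b\<close>: were
  \<open>p(x)\<close> bounded in \<open>b\<close>, then \<open>x\<close> would be a limit in \<open>E\<close> of a bounded part of \<open>H\<close>, and so lie in \<open>H\<close>.
\<close>

section \<open>Nested convex sets in Hilbert space and the Riesz representation\<close>

text \<open>The parallelogram identity turns a lower bound on the norm of the midpoint into
  closeness of \<open>u\<close> and \<open>v\<close>; the right-hand side is
  \<open>4 * (d + r)\<^sup>2 - 4 * d\<^sup>2\<close>.\<close>

lemma parallelogram_midpoint_bound:
  fixes u v :: "'h::real_inner"
  assumes "norm u \<le> d + r" "norm v \<le> d + r" "d \<le> norm ((1/2) *\<^sub>R (u + v))" "0 \<le> d" "0 \<le> r"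
  shows "(norm (u - v))\<^sup>2 \<le> 8 * d * r + 4 * r\<^sup>2"
proof -
  have "(norm (u - v))\<^sup>2 = 2 * (norm u)\<^sup>2 + 2 * (norm v)\<^sup>2 - 4 * (norm ((1/2) *\<^sub>R (u + v)))\<^sup>2"
    by (simp add: power2_norm_eq_inner inner_simps inner_commute algebra_simps)
  moreover have "(norm u)\<^sup>2 \<le> (d + r)\<^sup>2" "(norm v)\<^sup>2 \<le> (d + r)\<^sup>2" "d\<^sup>2 \<le> (norm ((1/2) *\<^sub>R (u + v)))\<^sup>2"
    using assms by (intro power_mono; simp)+
  ultimately show ?thesis by (simp add: power2_eq_square algebra_simps)
qed

text \<open>This plays the part of weak compactness: points of almost minimal norm in
  \<open>K n\<close> converge, and closedness puts the limit into every \<open>K n\<close>. It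
  yields both a maximizer for the Riesz representation and the closedness property behind
  \<open>mem_range_if_bounded_approximations\<close>.\<close>

lemma nested_closed_convex_Inter_nonempty:
  fixes K :: "nat \<Rightarrow> 'h::{real_inner, complete_space} set"
  assumes cl: "\<And>n. closed (K n)" and cv: "\<And>n. convex (K n)" and ne: "\<And>n. K n \<noteq> {}"
    and dec: "decseq K" and bd: "bounded (K 0)"
  obtains h where "\<And>n. h \<in> K n"
proof -
  define d where "d n = (INF h\<in>K n. norm h)" for n
  have bb: "bdd_below (norm ` K n)" for n by (rule bdd_belowI[of _ 0]) auto
  have dle: "d n \<le> norm h" if "h \<in> K n" for n h
    unfolding d_def using that bb by (rule cINF_lower[rotated])
  have d0: "0 \<le> d n" for n unfolding d_def using ne by (intro cINF_greatest) auto
  have sub: "K n \<subseteq> K m" if "m \<le> n" for m n using dec that by (auto simp: decseq_def)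
  have inc: "incseq d" unfolding incseq_def d_def
    using ne bb sub by (intro allI impI cINF_superset_mono) auto
  obtain B where B: "\<And>h. h \<in> K 0 \<Longrightarrow> norm h \<le> B" using bd by (auto simp: bounded_iff)
  have "d n \<le> B" for n
  proof -
    obtain h where "h \<in> K n" using ne by blast
    then show ?thesis using dle[of h n] B[of h] sub[of 0 n] by force
  qed
  then obtain D where D: "d \<longlonglongrightarrow> D" and dD: "\<And>n. d n \<le> D"
    using incseq_convergent[OF inc] by blast
  have "\<exists>h. h \<in> K n \<and> norm h < d n + 1 / Suc n" for n
    using cInf_lessD[of "norm ` K n" "d n + 1 / Suc n"] ne[of n] by (auto simp: d_def)
  then obtain h where hK: "\<And>n. h n \<in> K n" and hd: "\<And>n. norm (h n) < d n + 1 / Suc n" by metis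
  \<comment> \<open>Elements of almost minimal norm form a Cauchy sequence by the parallelogram law.\<close>
  define r where "r n = D - d n + 1 / Suc n" for n
  have r0: "0 \<le> r n" for n using dD[of n] by (simp add: r_def)
  have bound: "(norm (h n - h m))\<^sup>2 \<le> 8 * D * r n + 4 * (r n)\<^sup>2" if "n \<le> m" for n m
  proof -
    \<comment> \<open>For \<open>m \<ge> n\<close> the norm of \<open>h m\<close> is below
      \<open>d m + 1 / Suc m \<le> D + 1 / Suc n = d n + r n\<close>, so the slack
      \<open>r n\<close> serves for both vectors.\<close>
    have "1 / real (Suc m) \<le> 1 / Suc n" using that by (simp add: frac_le)
    then have a: "norm (h m) \<le> d n + r n" "norm (h n) \<le> d n + r n"
      using hd[of m] hd[of n] dD[of m] dD[of n] by (auto simp: r_def)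
    have "(1/2) *\<^sub>R h n + (1/2) *\<^sub>R h m \<in> K n"
      using cv hK sub[OF that] by (intro convexD) auto
    then have "d n \<le> norm ((1/2) *\<^sub>R (h n + h m))"
      using dle by (simp add: scaleR_add_right)
    from parallelogram_midpoint_bound[OF a(2) a(1) this d0 r0]
    have "(norm (h n - h m))\<^sup>2 \<le> 8 * d n * r n + 4 * (r n)\<^sup>2" .
    also have "\<dots> \<le> 8 * D * r n + 4 * (r n)\<^sup>2" using dD r0 by (simp add: mult_right_mono)
    finally show ?thesis .
  qed
  have "r \<longlonglongrightarrow> D - D + 0" unfolding r_def by (intro tendsto_intros D LIMSEQ_Suc[OF lim_1_over_n])
  then have "r \<longlonglongrightarrow> 0" by (simp only: diff_self add_0)
  then have "(\<lambda>n. 8 * D * r n + 4 * (r n)\<^sup>2) \<longlonglongrightarrow> 8 * D * 0 + 4 * 0\<^sup>2"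
    by (intro tendsto_intros)
  then have lim: "(\<lambda>n. 8 * D * r n + 4 * (r n)\<^sup>2) \<longlonglongrightarrow> 0" by simp
  have "Cauchy h"
  proof (rule metric_CauchyI)
    fix \<epsilon> :: real assume "\<epsilon> > 0"
    then have "\<forall>\<^sub>F n in sequentially. 8 * D * r n + 4 * (r n)\<^sup>2 < (\<epsilon>/2)\<^sup>2"
      using order_tendstoD(2)[OF lim, of "(\<epsilon>/2)\<^sup>2"] by simp
    then obtain N where N: "8 * D * r N + 4 * (r N)\<^sup>2 < (\<epsilon>/2)\<^sup>2"
      by (auto simp: eventually_sequentially)
    have half: "dist (h N) (h m) < \<epsilon>/2" if "m \<ge> N" for m
      using power_less_imp_less_base[OF order_le_less_trans[OF bound[OF that] N]] \<open>\<epsilon> > 0\<close>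
      by (simp add: dist_norm)
    show "\<exists>M. \<forall>m\<ge>M. \<forall>n\<ge>M. dist (h m) (h n) < \<epsilon>"
      using half dist_triangle_half_r by blast
  qed
  then obtain k where k: "h \<longlonglongrightarrow> k" using Cauchy_convergent convergent_def by blast
  have "k \<in> K n" for n
  proof (rule Lim_in_closed_set[OF cl _ _ k])
    show "\<forall>\<^sub>F m in sequentially. h m \<in> K n"
      using hK sub by (intro eventually_sequentiallyI[of n]) blast
  qed simp
  then show thesis by (rule that)
qed

text \<open>The norm \<open>a\<close> of \<open>f\<close> is attained on the unit ball, at a common
  point \<open>k\<close> of the nested sets of approximate maximizers; then
  \<open>a *\<^sub>R k\<close> represents \<open>f\<close>.\<close>

lemma riesz_representation:
  fixes f :: "'h::{real_inner, complete_space} \<Rightarrow> real"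
  assumes "bounded_linear f"
  obtains h where "\<And>k. f k = h \<bullet> k"
proof (cases "onorm f = 0")
  case True
  then show thesis using that[of 0] assms by (simp add: onorm_eq_0)
next
  case False
  interpret f: bounded_linear f by fact
  define a where "a = onorm f"
  have apos: "a > 0" using False onorm_pos_le[OF assms] by (simp add: a_def)
  have fle: "\<bar>f k\<bar> \<le> a * norm k" for k using onorm[OF assms, of k] by (simp add: a_def)
  define K where "K n = cball 0 1 \<inter> {k. a - 1 / Suc n \<le> f k}" for n
  have ne: "K n \<noteq> {}" for n
  proof (rule ccontr)
    \<comment> \<open>If \<open>K n\<close> were empty, \<open>f\<close> would stay below
      \<open>a - 1 / Suc n\<close> on the unit ball, and by symmetry so would its absolute value,
      contradicting that \<open>a\<close> is the operator norm.\<close>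
    assume "\<not> K n \<noteq> {}"
    then have lt: "f k < a - 1 / Suc n" if "norm k \<le> 1" for k using that by (force simp: K_def)
    have b0: "0 \<le> a - 1 / Suc n" using lt[of 0] by simp
    have "norm (f k) \<le> (a - 1 / Suc n) * norm k" for k
    proof (cases "k = 0")
      case False
      have "f (k /\<^sub>R norm k) < a - 1 / Suc n" "f (- (k /\<^sub>R norm k)) < a - 1 / Suc n"
        using False by (intro lt; simp)+
      then have "\<bar>f (k /\<^sub>R norm k)\<bar> < a - 1 / Suc n" by (simp add: f.neg)
      then show ?thesis using False by (simp add: f.scaleR abs_mult field_simps)
    qed simp
    then have "a \<le> a - 1 / Suc n" unfolding a_def using onorm_bound b0 a_def by blast
    then show False by simp
  qed
  obtain k where k: "\<And>n. k \<in> K n"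
  proof (rule nested_closed_convex_Inter_nonempty[of K])
    show "closed (K n)" for n unfolding K_def
      by (intro closed_Int closed_cball closed_Collect_le continuous_intros f.continuous_on)
    show "convex (K n)" for n
    proof -
      have "{k. a - 1 / Suc n \<le> f k} = f -` {a - 1 / Suc n..}" by auto
      then show ?thesis unfolding K_def
        by (simp add: convex_Int convex_linear_vimage f.linear)
    qed
    show "decseq K" unfolding decseq_def K_def
    proof (intro allI impI Int_mono order_refl subsetI)
      fix m n :: nat and k assume "m \<le> n" and k: "k \<in> {k. a - 1 / Suc n \<le> f k}"
      then have "1 / real (Suc n) \<le> 1 / Suc m" by (simp add: frac_le)
      then show "k \<in> {k. a - 1 / Suc m \<le> f k}" using k by simp
    qed
    show "bounded (K 0)" unfolding K_def by (intro bounded_Int disjI1 bounded_cball)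
  qed (use ne in auto)
  have nk: "norm k \<le> 1" using k[of 0] by (simp add: K_def)
  have "(\<lambda>n::nat. a - 1 / Suc n) \<longlonglongrightarrow> a - 0" by (intro tendsto_intros LIMSEQ_Suc[OF lim_1_over_n])
  then have "a \<le> f k" using k by (intro LIMSEQ_le_const2[of "\<lambda>n::nat. a - 1 / Suc n"]) (auto simp: K_def)
  moreover have "f k \<le> a" using fle[of k] nk apos mult_left_le[of "norm k" a] by linarith
  ultimately have fk: "f k = a" by simp
  have "f j = (a *\<^sub>R k) \<bullet> j" for j
  proof -
    \<comment> \<open>\<open>\<bar>f\<bar> \<le> a \<parallel>\<cdot>\<parallel>\<close> is an equality at \<open>k\<close>, so the derivative in every direction \<open>j\<close> agrees there.\<close>
    define A where "A = a\<^sup>2 * (k \<bullet> j) - a * f j"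
    define B where "B = a\<^sup>2 * (norm j)\<^sup>2 - (f j)\<^sup>2"
    have quad: "0 \<le> 2 * t * A + t\<^sup>2 * B" for t
    proof -
      have "(f (k + t *\<^sub>R j))\<^sup>2 \<le> (a * norm (k + t *\<^sub>R j))\<^sup>2"
        using fle[of "k + t *\<^sub>R j"] abs_le_square_iff[of "f (k + t *\<^sub>R j)" "a * norm (k + t *\<^sub>R j)"] apos by simp
      then have "(a + t * f j)\<^sup>2 \<le> a\<^sup>2 * ((norm k)\<^sup>2 + 2 * t * (k \<bullet> j) + t\<^sup>2 * (norm j)\<^sup>2)"
        by (simp add: f.add f.scaleR fk power_mult_distrib power2_norm_eq_inner inner_simps inner_commute)
           (simp add: power2_eq_square algebra_simps)
      moreover have "a\<^sup>2 * (norm k)\<^sup>2 \<le> a\<^sup>2 * 1"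
        using nk by (intro mult_left_mono) (simp_all add: power_le_one)
      ultimately show ?thesis by (simp add: A_def B_def power2_eq_square algebra_simps)
    qed
    have "A = 0"
    proof (rule ccontr)
      assume "A \<noteq> 0"
      \<comment> \<open>A small step against the sign of \<open>A\<close>, for which the linear term
        outweighs the quadratic one; \<open>\<bar>B\<bar> + 1\<close> keeps the denominator positive
        whatever \<open>B\<close> is.\<close>
      define s where "s = - A / (\<bar>B\<bar> + 1)"
      have "s\<^sup>2 * B \<le> s\<^sup>2 * (\<bar>B\<bar> + 1)" by (intro mult_left_mono) auto
      also have "\<dots> = - s * A" by (simp add: s_def power2_eq_square)
      finally have "0 \<le> s * A" using quad[of s] by simp
      moreover have "s * A = - (A\<^sup>2 / (\<bar>B\<bar> + 1))" by (simp add: s_def power2_eq_square)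
      moreover have "0 < A\<^sup>2 / (\<bar>B\<bar> + 1)" using \<open>A \<noteq> 0\<close> by (intro divide_pos_pos) auto
      ultimately show False by simp
    qed
    then show ?thesis using apos by (simp add: A_def power2_eq_square)
  qed
  then show thesis by (rule that)
qed

section \<open>Sublinear functionals and the Hahn-Banach theorem\<close>

text \<open>An inequality for positive \<open>c\<close> is enough: applied to the inverse of
  \<open>c\<close> as well, it gives equality, and \<open>p 0 = 0\<close> follows from the factors
  \<open>1/2\<close> and \<open>2\<close>.\<close>

definition sublinear :: "('a::real_vector \<Rightarrow> real) \<Rightarrow> bool" where
  "sublinear p \<longleftrightarrow> (\<forall>x y. p (x + y) \<le> p x + p y) \<and> (\<forall>c>0. \<forall>x. p (c *\<^sub>R x) \<le> c * p x)"

lemma sublinearI: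
  "(\<And>x y. p (x + y) \<le> p x + p y) \<Longrightarrow> (\<And>c x. c > 0 \<Longrightarrow> p (c *\<^sub>R x) \<le> c * p x) \<Longrightarrow> sublinear p"
  by (simp add: sublinear_def)

lemma sublinear_add: "sublinear p \<Longrightarrow> p (x + y) \<le> p x + p y"
  by (simp add: sublinear_def)

lemma sublinear_zero:
  assumes "sublinear p" shows "p 0 = 0"
proof -
  have "p ((1/2) *\<^sub>R 0) \<le> (1/2) * p 0" "p (2 *\<^sub>R 0) \<le> 2 * p 0"
    using assms by (simp_all only: sublinear_def)
  then show ?thesis by simp
qed

lemma sublinear_scaleR:
  assumes "sublinear p" "c \<ge> 0" shows "p (c *\<^sub>R x) = c * p x"
proof (cases "c = 0")
  case True then show ?thesis using sublinear_zero[OF assms(1)] by simp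
next
  case False
  then have c: "c > 0" using assms(2) by simp
  have "p (inverse c *\<^sub>R (c *\<^sub>R x)) \<le> inverse c * p (c *\<^sub>R x)"
    using assms(1) c unfolding sublinear_def by (meson positive_imp_inverse_positive)
  then have "c * p x \<le> p (c *\<^sub>R x)" using c by (simp add: field_simps)
  moreover have "p (c *\<^sub>R x) \<le> c * p x" using assms(1) c by (simp add: sublinear_def)
  ultimately show ?thesis by simp
qed

lemma sublinear_neg: "sublinear p \<Longrightarrow> - p (- x) \<le> p x"
  using sublinear_add[of p x "- x"] sublinear_zero[of p] by simp

text \<open>A minimal sublinear functional is not diminished by this construction, hence is odd and therefore
  linear; Hahn-Banach thus needs no extension over subspaces.\<close>

lemma sublinear_directional:
  fixes y :: "'a::real_vector"
  assumes q: "sublinear q"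
  defines "r \<equiv> \<lambda>x. INF t\<in>{0::real..}. q (x + t *\<^sub>R y) - t * q y"
  shows "sublinear r" "r \<le> q" "r (- y) \<le> - q y"
proof -
  have bb: "bdd_below ((\<lambda>t. q (x + t *\<^sub>R y) - t * q y) ` {0..})" for x
  proof (rule bdd_belowI)
    fix s assume "s \<in> (\<lambda>t. q (x + t *\<^sub>R y) - t * q y) ` {0..}"
    then obtain t where t: "t \<ge> 0" "s = q (x + t *\<^sub>R y) - t * q y" by auto
    \<comment> \<open>The lower bound \<open>- q (- x)\<close> does not depend on \<open>t\<close>,
      so the infimum is a genuine real number.\<close>
    have "q (t *\<^sub>R y) \<le> q (x + t *\<^sub>R y) + q (- x)"
      using sublinear_add[OF q, of "x + t *\<^sub>R y" "- x"] by simp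
    then show "- q (- x) \<le> s" using t sublinear_scaleR[OF q] by simp
  qed
  have le: "r x \<le> q (x + t *\<^sub>R y) - t * q y" if "t \<ge> 0" for x t
    unfolding r_def using that by (intro cINF_lower bb) auto
  have ge: "m \<le> r x" if "\<And>t. t \<ge> 0 \<Longrightarrow> m \<le> q (x + t *\<^sub>R y) - t * q y" for m x
    unfolding r_def using that by (intro cINF_greatest) auto
  show "sublinear r"
  proof (rule sublinearI)
    fix u v
    \<comment> \<open>Parameters \<open>s\<close> for \<open>u\<close> and \<open>t\<close> for
      \<open>v\<close> are merged into \<open>s + t\<close> for the sum; the infimum is then taken
      over one parameter at a time.\<close>
    have "r (u + v) - (q (v + t *\<^sub>R y) - t * q y) \<le> q (u + s *\<^sub>R y) - s * q y" if "s \<ge> 0" "t \<ge> 0" for s t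
      using le[of "s + t" "u + v"] that sublinear_add[OF q, of "u + s *\<^sub>R y" "v + t *\<^sub>R y"]
      by (simp add: algebra_simps)
    then have "r (u + v) - (q (v + t *\<^sub>R y) - t * q y) \<le> r u" if "t \<ge> 0" for t
      using that by (intro ge) auto
    then have "r (u + v) - r u \<le> q (v + t *\<^sub>R y) - t * q y" if "t \<ge> 0" for t
      using that by (simp add: algebra_simps)
    then have "r (u + v) - r u \<le> r v" by (rule ge)
    then show "r (u + v) \<le> r u + r v" by simp
  next
    fix c :: real and u assume c: "c > 0"
    have "r (c *\<^sub>R u) / c \<le> q (u + t *\<^sub>R y) - t * q y" if "t \<ge> 0" for t
    proof -
      have "r (c *\<^sub>R u) \<le> q (c *\<^sub>R (u + t *\<^sub>R y)) - (c * t) * q y"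
        using le[of "c * t" "c *\<^sub>R u"] that c by (simp add: scaleR_add_right)
      also have "q (c *\<^sub>R (u + t *\<^sub>R y)) = c * q (u + t *\<^sub>R y)"
        using c by (intro sublinear_scaleR[OF q]) simp
      finally show ?thesis using c by (simp add: field_simps)
    qed
    then have "r (c *\<^sub>R u) / c \<le> r u" by (rule ge)
    then show "r (c *\<^sub>R u) \<le> c * r u" using c by (simp add: field_simps)
  qed
  show "r \<le> q" using le[of 0] by (auto simp: le_fun_def)
  show "r (- y) \<le> - q y" using le[of 1 "- y"] sublinear_zero[OF q] by simp
qed

text \<open>Zorn's lemma with pointwise infima as chain bounds. The infimum is finite since each
  member satisfies \<open>- p (- x) \<le> q x\<close>, and subadditive since of two members of a
  chain one lies below both.\<close>

lemma exists_minimal_sublinear: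
  assumes p: "sublinear p"
  obtains m where "sublinear m" "m \<le> p" "\<And>q. sublinear q \<Longrightarrow> q \<le> m \<Longrightarrow> q = m"
proof -
  define A where "A = {q. sublinear q \<and> q \<le> p}"
  \<comment> \<open>The order is reversed, so that a maximal element in the sense of Zorn is a
    minimal functional.\<close>
  let ?P = "\<lambda>f g :: 'a \<Rightarrow> real. g \<le> f"
  have "\<exists>m\<in>A. \<forall>a\<in>A. ?P m a \<longrightarrow> a = m"
  proof (rule predicate_Zorn)
    show "partial_order_on A (relation_of ?P A)"
      by (rule partial_order_on_relation_ofI) auto
    fix C assume C: "C \<in> Chains (relation_of ?P A)"
    then have CA: "C \<subseteq> A" and tot: "\<And>f g. f \<in> C \<Longrightarrow> g \<in> C \<Longrightarrow> f \<le> g \<or> g \<le> f"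
      by (auto simp: Chains_def relation_of_def)
    show "\<exists>u\<in>A. \<forall>a\<in>C. ?P a u"
    proof (cases "C = {}")
      case True then show ?thesis using p by (auto simp: A_def)
    next
      case False
      define u where "u x = (INF q\<in>C. q x)" for x
      have bb: "bdd_below ((\<lambda>q. q x) ` C)" for x
      proof (rule bdd_belowI2)
        fix q assume "q \<in> C"
        then have "sublinear q" "q (- x) \<le> p (- x)" using CA by (auto simp: A_def le_fun_def)
        then show "- p (- x) \<le> q x" using sublinear_neg[of q x] by linarith
      qed
      have le: "u x \<le> q x" if "q \<in> C" for q x
        unfolding u_def using that by (intro cINF_lower bb)
      have ge: "s \<le> u x" if "\<And>q. q \<in> C \<Longrightarrow> s \<le> q x" for s x
        unfolding u_def using that False by (intro cINF_greatest) auto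
      have "sublinear u"
      proof (rule sublinearI)
        fix x y
        have "u (x + y) - g y \<le> f x" if fg: "f \<in> C" "g \<in> C" for f g
        proof -
          obtain h where h: "h \<in> C" "h \<le> f" "h \<le> g" using tot[OF fg] fg by auto
          have "u (x + y) \<le> h x + h y"
            using le[OF h(1), of "x + y"] h(1) CA sublinear_add[of h x y] by (auto simp: A_def)
          also have "\<dots> \<le> f x + g y" using h by (simp add: add_mono le_fun_def)
          finally show ?thesis by simp
        qed
        then have "u (x + y) - g y \<le> u x" if "g \<in> C" for g using that by (intro ge)
        then have "u (x + y) - u x \<le> g y" if "g \<in> C" for g using that by (simp add: algebra_simps)
        then have "u (x + y) - u x \<le> u y" by (rule ge)
        then show "u (x + y) \<le> u x + u y" by simp
      next
        fix c :: real and x assume c: "c > 0"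
        have "u (c *\<^sub>R x) / c \<le> q x" if "q \<in> C" for q
        proof -
          have "sublinear q" using that CA by (auto simp: A_def)
          then have "u (c *\<^sub>R x) \<le> c * q x"
            using le[OF that, of "c *\<^sub>R x"] c by (simp add: sublinear_scaleR)
          then show ?thesis using c by (simp add: field_simps)
        qed
        then have "u (c *\<^sub>R x) / c \<le> u x" by (rule ge)
        then show "u (c *\<^sub>R x) \<le> c * u x" using c by (simp add: field_simps)
      qed
      moreover have "u \<le> p"
      proof -
        obtain q where "q \<in> C" using False by blast
        then have "u \<le> q" "q \<le> p" using le CA by (auto simp: le_fun_def A_def)
        then show ?thesis by (rule order_trans)
      qed
      ultimately show ?thesis using le by (auto simp: A_def le_fun_def)
    qed
  qed
  then obtain m where m: "m \<in> A" "\<And>a. a \<in> A \<Longrightarrow> a \<le> m \<Longrightarrow> a = m" by auto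
  show thesis
  proof (rule that)
    show "sublinear m" "m \<le> p" using m(1) by (auto simp: A_def)
    show "q = m" if "sublinear q" "q \<le> m" for q
      using m that order_trans[of q m p] by (auto simp: A_def)
  qed
qed

text \<open>Minimizing below the directional functional \<open>p'\<close> instead of
  \<open>p\<close> secures the value at \<open>y\<close>: a linear \<open>m \<le> p'\<close> has
  \<open>- m y = m (- y) \<le> - p y\<close>.\<close>

lemma hahn_banach_sublinear:
  assumes p: "sublinear p"
  obtains l where "linear l" "\<And>x. l x \<le> p x" "l y = p y"
proof -
  define p' where "p' x = (INF t\<in>{0::real..}. p (x + t *\<^sub>R y) - t * p y)" for x
  note p' = sublinear_directional[OF p, of y, folded p'_def]
  obtain m where m: "sublinear m" "m \<le> p'" and min: "\<And>q. sublinear q \<Longrightarrow> q \<le> m \<Longrightarrow> q = m"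
    using exists_minimal_sublinear[OF p'(1)] by blast
  have neg: "m (- z) = - m z" for z
  proof (rule antisym)
    define r where "r x = (INF t\<in>{0::real..}. m (x + t *\<^sub>R z) - t * m z)" for x
    note r = sublinear_directional[OF m(1), of z, folded r_def]
    have "r = m" using min r by blast
    then show "m (- z) \<le> - m z" using r(3) by simp
    show "- m z \<le> m (- z)" using sublinear_neg[OF m(1), of "- z"] by simp
  qed
  have add: "m (u + v) = m u + m v" for u v
  proof (rule antisym)
    show "m (u + v) \<le> m u + m v" using sublinear_add[OF m(1)] .
    have "m (- u + - v) \<le> m (- u) + m (- v)" using sublinear_add[OF m(1)] .
    then show "m u + m v \<le> m (u + v)" using neg[of "u + v"] neg by simp
  qed
  have mp: "m x \<le> p x" for x using m(2) p'(2) by (metis le_funD order_trans)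
  show thesis
  proof (rule that)
    show "linear m"
    proof (rule linearI)
      show "m (c *\<^sub>R u) = c *\<^sub>R m u" for c u
      proof (cases "c \<ge> 0")
        case True then show ?thesis using sublinear_scaleR[OF m(1)] by simp
      next
        case False
        then show ?thesis using sublinear_scaleR[OF m(1), of "- c" u] neg[of "c *\<^sub>R u"] by simp
      qed
    qed (rule add)
    show "m x \<le> p x" for x by (rule mp)
    have "m (- y) \<le> - p y" using m(2) p'(3) by (meson le_funD order_trans)
    then show "m y = p y" using mp[of y] neg[of y] by simp
  qed
qed

section \<open>Cosets of a subspace of full measure\<close>

lemma suminf_ennreal_finite_iff:
  "(\<And>n. 0 \<le> f n) \<Longrightarrow> (\<Sum>n. ennreal (f n)) < \<top> \<longleftrightarrow> summable f"
  using summable_suminf_not_top[of f] ennreal_suminf_neq_top[of f]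
  unfolding less_top[symmetric] by blast

text \<open>For nonnegative terms, convergence is finiteness of the sum in
  \<open>[0, \<infinity>]\<close>, which is a measurable function.\<close>

lemma borel_summable_set:
  fixes f :: "nat \<Rightarrow> 'a::topological_space \<Rightarrow> real"
  assumes "\<And>n. continuous_on UNIV (f n)" "\<And>n z. 0 \<le> f n z"
  shows "{z. summable (\<lambda>n. f n z)} \<in> sets borel"
proof -
  have [measurable]: "f n \<in> borel_measurable borel" for n
    using assms(1) by (rule borel_measurable_continuous_onI)
  have "{z. summable (\<lambda>n. f n z)} = {z \<in> space borel. (\<Sum>n. ennreal (f n z)) < \<infinity>}"
    using assms(2) by (simp add: suminf_ennreal_finite_iff)
  also have "\<dots> \<in> sets borel" by measurable
  finally show ?thesis .
qed

text \<open>The factor \<open>2\<close> and the unspecified \<open>g\<close> let one lemma cover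
  squared norms, with \<open>g c = c\<^sup>2\<close>, and absolute values, with
  \<open>g c = \<bar>c\<bar>\<close>.\<close>

lemma subspace_summable_set:
  fixes f :: "nat \<Rightarrow> 'a::real_vector \<Rightarrow> real"
  assumes "\<And>n z. 0 \<le> f n z"
    and "\<And>n y z. f n (y + z) \<le> 2 * (f n y + f n z)"
    and "\<And>n c z. f n (c *\<^sub>R z) = g c * f n z"
    and "\<And>n. f n 0 = 0"
  shows "subspace {z. summable (\<lambda>n. f n z)}"
proof (rule subspaceI)
  show "0 \<in> {z. summable (\<lambda>n. f n z)}" using assms(4) by simp
  show "c *\<^sub>R z \<in> {z. summable (\<lambda>n. f n z)}" if "z \<in> {z. summable (\<lambda>n. f n z)}" for c z
    using that by (simp add: assms(3) summable_mult)
  fix y z assume "y \<in> {z. summable (\<lambda>n. f n z)}" "z \<in> {z. summable (\<lambda>n. f n z)}"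
  then have "summable (\<lambda>n. 2 * (f n y + f n z))" by (intro summable_mult summable_add) auto
  then show "y + z \<in> {z. summable (\<lambda>n. f n z)}"
    using assms(1,2) by (auto intro: summable_comparison_test')
qed

section \<open>Translates, cosets and representatives\<close>

lemma translate_iff: "y \<in> translate V z \<longleftrightarrow> y - z \<in> V"
  for V :: "'a::ab_group_add set"
proof
  assume "y - z \<in> V"
  then have "(y - z) + z \<in> translate V z" unfolding translate_def by (rule imageI)
  then show "y \<in> translate V z" by simp
qed (auto simp: translate_def)

lemma borel_translate:
  fixes V :: "'a::real_normed_vector set"
  assumes "V \<in> sets borel"
  shows "translate V z \<in> sets borel"
proof -
  have m: "(\<lambda>y. y - z) \<in> borel_measurable borel"
    by (intro borel_measurable_continuous_onI continuous_intros)
  have "translate V z = (\<lambda>y. y - z) -` V \<inter> space borel" by (auto simp: translate_iff)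
  then show ?thesis using measurable_sets[OF m assms] by simp
qed

lemma equiv_diff_rel:
  assumes "subspace V" shows "equiv UNIV (diff_rel V)"
proof (rule equivI)
  show "refl (diff_rel V)" using subspace_0[OF assms] by (auto simp: refl_on_def diff_rel_def)
  show "sym (diff_rel V)"
  proof (rule symI)
    fix y z assume "(y, z) \<in> diff_rel V"
    then show "(z, y) \<in> diff_rel V" using subspace_neg[OF assms, of "y - z"] by (simp add: diff_rel_def)
  qed
  show "trans (diff_rel V)"
  proof (rule transI)
    fix w y z assume "(w, y) \<in> diff_rel V" "(y, z) \<in> diff_rel V"
    then show "(w, z) \<in> diff_rel V"
      using subspace_add[OF assms, of "w - y" "y - z"] by (simp add: diff_rel_def)
  qed
qed auto

lemma subspace_minus_commute_iff: "subspace V \<Longrightarrow> y - z \<in> V \<longleftrightarrow> z - y \<in> V"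
  using subspace_neg[of V "y - z"] subspace_neg[of V "z - y"] by auto

lemma diff_rel_Image:
  assumes "subspace V" shows "diff_rel V `` {z} = translate V z"
  using subspace_minus_commute_iff[OF assms] by (auto simp: diff_rel_def translate_iff)

text \<open>The class of \<open>y\<close> is \<open>translate V y\<close>, so uniqueness per class
  becomes uniqueness per point. Existence then gives the covering of the space, uniqueness the
  disjointness.\<close>

lemma class_representatives_translate:
  assumes "subspace V" "class_representatives (diff_rel V) \<tau>"
  shows "\<exists>!z. z \<in> \<tau> \<and> y - z \<in> V"
proof -
  have "translate V y \<in> UNIV // diff_rel V"
    unfolding diff_rel_Image[OF assms(1), symmetric] by (rule quotientI) simp
  then have "\<exists>!z. z \<in> \<tau> \<and> z - y \<in> V"
    using assms(2) by (simp add: class_representatives_def flip: translate_iff)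
  then show ?thesis unfolding subspace_minus_commute_iff[OF assms(1), of _ y] .
qed

lemma exists_class_representatives:
  assumes "equiv UNIV r"
  obtains \<tau> where "class_representatives r \<tau>"
proof -
  have ne: "C \<noteq> {}" if "C \<in> UNIV // r" for C
    using that assms in_quotient_imp_non_empty by blast
  define \<tau> where "\<tau> = (\<lambda>C. SOME z. z \<in> C) ` (UNIV // r)"
  have "\<exists>!z. z \<in> \<tau> \<and> z \<in> C" if C: "C \<in> UNIV // r" for C
  proof (rule ex1I[of _ "SOME z. z \<in> C"])
    show "(SOME z. z \<in> C) \<in> \<tau> \<and> (SOME z. z \<in> C) \<in> C"
      using C ne[OF C] by (auto simp: \<tau>_def some_in_eq)
    fix z assume z: "z \<in> \<tau> \<and> z \<in> C"
    then obtain D where D: "D \<in> UNIV // r" "z = (SOME z. z \<in> D)" by (auto simp: \<tau>_def)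
    then have "z \<in> D" using ne by (simp add: some_in_eq)
    then have "C = D" using quotient_disj[OF assms C D(1)] z by blast
    then show "z = (SOME z. z \<in> C)" using D by simp
  qed
  then have "class_representatives r \<tau>" unfolding class_representatives_def by blast
  then show thesis by (rule that)
qed

lemma uncountable_class_representatives:
  fixes V :: "'a::real_vector set"
  assumes V: "subspace V" and "x \<notin> V" and \<tau>: "class_representatives (diff_rel V) \<tau>"
  shows "uncountable \<tau>"
proof -
  note ex1 = class_representatives_translate[OF V \<tau>]
  \<comment> \<open>\<open>\<rho> s\<close> represents the coset of \<open>s *\<^sub>R x\<close>; a
    coincidence of two values would put a nonzero multiple of \<open>x\<close> into
    \<open>V\<close>.\<close>
  obtain \<rho> where \<rho>: "\<And>s::real. \<rho> s \<in> \<tau>" "\<And>s. s *\<^sub>R x - \<rho> s \<in> V"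
  proof -
    have "\<forall>s. \<exists>z. z \<in> \<tau> \<and> s *\<^sub>R x - z \<in> V" using ex1 by blast
    then show thesis using that by metis
  qed
  have "inj \<rho>"
  proof (rule injI)
    fix s t assume eq: "\<rho> s = \<rho> t"
    have "(s *\<^sub>R x - \<rho> s) - (t *\<^sub>R x - \<rho> t) \<in> V" by (rule subspace_diff[OF V \<rho>(2) \<rho>(2)])
    then have *: "(s - t) *\<^sub>R x \<in> V" using eq by (simp add: algebra_simps)
    show "s = t"
    proof (rule ccontr)
      assume "s \<noteq> t"
      then show False using subspace_mul[OF V *, of "inverse (s - t)"] \<open>x \<notin> V\<close> by simp
    qed
  qed
  show ?thesis
  proof
    assume "countable \<tau>"
    then have "countable (range \<rho>)" by (rule countable_subset[rotated]) (use \<rho>(1) in blast)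
    then show False using countable_image_inj_on[OF _ \<open>inj \<rho>\<close>] uncountable_UNIV_real by blast
  qed
qed

section \<open>Invariance under the Brownian transition function\<close>

lemma brownian_invariant_translate:
  fixes \<mu> :: "'e::banach measure"
  assumes "prob_space \<mu>" and sets: "sets \<mu> = sets borel"
    and V: "subspace V" "V \<in> sets borel" and ae: "AE w in \<mu>. w \<in> V"
  shows "brownian_invariant \<mu> (translate V z)"
  unfolding brownian_invariant_def
proof (intro allI impI ext)
  fix t :: real and y assume "t > 0"
  interpret prob_space \<mu> by fact
  have m: "(\<lambda>w. sqrt t *\<^sub>R w) \<in> measurable \<mu> borel"
    unfolding measurable_cong_sets[OF sets refl]
    by (intro borel_measurable_continuous_onI continuous_intros)
  interpret S: prob_space "scaled_measure \<mu> t"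
    unfolding scaled_measure_def by (rule prob_space_distr[OF m])
  \<comment> \<open>Full measure passes from \<open>\<mu>\<close> to the scaled measure because a
    subspace is stable under multiplication by \<open>sqrt t\<close>.\<close>
  have "AE w in scaled_measure \<mu> t. w \<in> V"
    unfolding scaled_measure_def
  proof (subst AE_distr_iff[OF m])
    show "{w \<in> space borel. w \<in> V} \<in> sets borel" using V(2) by simp
    show "AE w in \<mu>. sqrt t *\<^sub>R w \<in> V" using ae by eventually_elim (rule subspace_mul[OF V(1)])
  qed
  then have eq: "AE w in scaled_measure \<mu> t.
      indicat_real (translate V z) (y + w) = indicat_real (translate V z) y"
  proof eventually_elim
    case (elim w)
    then have "y - z \<in> V" if "y + w - z \<in> V"
      using subspace_diff[OF V(1) that elim] by (simp add: algebra_simps)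
    moreover have "y + w - z \<in> V" if "y - z \<in> V"
      using subspace_add[OF V(1) that elim] by (simp add: algebra_simps)
    ultimately show ?case by (auto simp: indicator_def translate_iff)
  qed
  have "(\<lambda>w. y + w) \<in> borel_measurable borel"
    by (intro borel_measurable_continuous_onI continuous_intros)
  then have "(\<lambda>w. indicat_real (translate V z) (y + w)) \<in> borel_measurable (scaled_measure \<mu> t)"
    unfolding scaled_measure_def measurable_distr_eq1
    by (rule measurable_compose[OF _ borel_measurable_indicator[OF borel_translate[OF V(2)]]])
  then have "brownian_transition \<mu> t (indicat_real (translate V z)) y =
      (\<integral>w. indicat_real (translate V z) y \<partial>scaled_measure \<mu> t)"
    unfolding brownian_transition_def by (intro integral_cong_AE eq) auto
  then show "brownian_transition \<mu> t (indicat_real (translate V z)) y = indicat_real (translate V z) y"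
    by (simp add: S.prob_space)
qed

text \<open>Kept general in \<open>V\<close>, so that it serves both \<open>E_sub\<close> and the
  subspace constructed without a basis.\<close>

lemma translate_partition:
  fixes \<mu> :: "'e::banach measure"
  assumes "prob_space \<mu>" "sets \<mu> = sets borel"
    and V: "subspace V" "V \<in> sets borel" and "AE w in \<mu>. w \<in> V" and "x \<notin> V"
    and \<tau>: "class_representatives (diff_rel V) \<tau>"
  shows "uncountable \<tau>" "(\<Union>z\<in>\<tau>. translate V z) = UNIV" "disjoint_family_on (translate V) \<tau>"
    "\<forall>z\<in>\<tau>. translate V z \<in> sets borel \<and> brownian_invariant \<mu> (translate V z)"
proof -
  note ex1 = class_representatives_translate[OF V(1) \<tau>]
  show "uncountable \<tau>" using uncountable_class_representatives V(1) \<open>x \<notin> V\<close> \<tau> by blast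
  show "(\<Union>z\<in>\<tau>. translate V z) = UNIV" using ex1 by (auto simp: translate_iff) blast
  show "disjoint_family_on (translate V) \<tau>"
    unfolding disjoint_family_on_def by (auto simp: translate_iff) (use ex1 in blast)
  show "\<forall>z\<in>\<tau>. translate V z \<in> sets borel \<and> brownian_invariant \<mu> (translate V z)"
    using assms borel_translate brownian_invariant_translate by blast
qed

section \<open>Almost sure summability of Gaussian functionals\<close>

lemma nn_integral_abs_normal_law:
  assumes "0 \<le> s" "s \<le> 1"
  shows "(\<integral>\<^sup>+ r. ennreal \<bar>r\<bar> \<partial>normal_law 0 (s\<^sup>2)) \<le> 1"
proof (cases "s = 0")
  case True
  then show ?thesis by (simp add: normal_law_def nn_integral_return)
next
  case False
  then have s: "s > 0" using assms by simp
  \<comment> \<open>The first absolute moment of a centred normal law with deviation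
    \<open>s\<close> is \<open>s * sqrt (2 / pi)\<close>, at most \<open>1\<close> for
    \<open>s \<le> 1\<close>; the point mass at \<open>0\<close> was treated separately.\<close>
  have bi: "has_bochner_integral lborel (\<lambda>r. normal_density 0 s r * \<bar>r\<bar>) (s * sqrt (2 / pi))"
    using normal_moment_abs_odd[OF s, of 0 0] by simp
  have "(\<integral>\<^sup>+ r. ennreal \<bar>r\<bar> \<partial>normal_law 0 (s\<^sup>2)) = (\<integral>\<^sup>+ r. ennreal (normal_density 0 s r * \<bar>r\<bar>) \<partial>lborel)"
    using s by (simp add: normal_law_def nn_integral_density ennreal_mult)
  also have "\<dots> = ennreal (s * sqrt (2 / pi))"
    using s bi
    by (subst nn_integral_eq_integral)
       (auto simp: has_bochner_integral_iff)
  also have "s * sqrt (2 / pi) \<le> 1 * 1"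
    using assms pi_gt3 by (intro mult_mono) auto
  finally show ?thesis by (simp add: ennreal_leI)
qed

context abstract_wiener_space
begin

lemma measurable_blinfun: "blinfun_apply l \<in> borel_measurable \<mu>" for l :: "'e \<Rightarrow>\<^sub>L real"
  unfolding measurable_cong_sets[OF sets_borel refl]
  by (intro borel_measurable_continuous_onI continuous_intros)

text \<open>Each functional has first absolute moment at most \<open>1\<close>, so the nonnegative
  series has expectation at most \<open>\<Sum>n. c n\<close>; finite expectation forces finiteness
  almost surely.\<close>

lemma AE_summable_functionals:
  fixes l :: "nat \<Rightarrow> 'e \<Rightarrow>\<^sub>L real"
  assumes "\<And>n. norm (dual_to_H \<iota> (l n)) \<le> 1" "summable c" "\<And>n. 0 \<le> c n"
  shows "AE z in \<mu>. summable (\<lambda>n. c n * \<bar>l n z\<bar>)"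
proof -
  note measurable_blinfun[measurable]
  have 1: "(\<integral>\<^sup>+ z. ennreal \<bar>l n z\<bar> \<partial>\<mu>) \<le> 1" for n
  proof -
    have "(\<integral>\<^sup>+ z. ennreal \<bar>l n z\<bar> \<partial>\<mu>) = (\<integral>\<^sup>+ r. ennreal \<bar>r\<bar> \<partial>distr \<mu> borel (l n))"
      by (subst nn_integral_distr) (auto intro: measurable_blinfun)
    also have "\<dots> \<le> 1" unfolding gaussian by (intro nn_integral_abs_normal_law assms) simp
    finally show ?thesis .
  qed
  have "(\<integral>\<^sup>+ z. (\<Sum>n. ennreal (c n * \<bar>l n z\<bar>)) \<partial>\<mu>) = (\<Sum>n. ennreal (c n) * (\<integral>\<^sup>+ z. ennreal \<bar>l n z\<bar> \<partial>\<mu>))"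
    by (simp add: nn_integral_suminf nn_integral_cmult ennreal_mult assms(3))
  also have "\<dots> \<le> (\<Sum>n. ennreal (c n))"
    using mult_left_mono[OF 1] by (intro suminf_le) auto
  also have "\<dots> < \<top>" using suminf_ennreal_finite_iff[of c] assms(2,3) by blast
  finally have "AE z in \<mu>. (\<Sum>n. ennreal (c n * \<bar>l n z\<bar>)) \<noteq> \<infinity>"
    by (intro nn_integral_PInf_AE) auto
  then show ?thesis
    by eventually_elim (use assms(3) suminf_ennreal_finite_iff in \<open>auto simp: less_top\<close>)
qed

end

section \<open>Functionals that are large at a point outside \<open>H\<close>\<close>

text \<open>The approximating \<open>h\<close> of norm at most \<open>M\<close> form nested closed
  convex sets \<open>K n\<close>, and a common point is mapped to \<open>x\<close> exactly. This is
  where completeness of the Hilbert space enters the separation of \<open>x\<close>.\<close>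

lemma mem_range_if_bounded_approximations:
  fixes \<iota> :: "'h::{real_inner, complete_space} \<Rightarrow> 'e::real_normed_vector"
  assumes \<iota>: "bounded_linear \<iota>"
    and approx: "\<And>n. \<exists>h. norm h \<le> M \<and> norm (x - \<iota> h) \<le> M / Suc n"
  shows "x \<in> range \<iota>"
proof -
  interpret \<iota>: bounded_linear \<iota> by fact
  define K where "K n = cball 0 M \<inter> \<iota> -` cball x (M / Suc n)" for n
  have M: "0 \<le> M" using approx[of 0] norm_ge_zero order_trans by blast
  obtain k where k: "\<And>n. k \<in> K n"
  proof (rule nested_closed_convex_Inter_nonempty[of K])
    show "closed (K n)" for n unfolding K_def
      by (intro closed_Int closed_cball closed_vimage \<iota>.continuous_on continuous_intros)
    show "convex (K n)" for n unfolding K_def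
      by (intro convex_Int convex_cball convex_linear_vimage \<iota>.linear)
    show "decseq K" unfolding decseq_def K_def
    proof (intro allI impI Int_mono order_refl vimage_mono subset_cball)
      fix m n :: nat assume "m \<le> n"
      then show "M / real (Suc n) \<le> M / Suc m" using M by (intro divide_left_mono) auto
    qed
    show "bounded (K 0)" unfolding K_def by (intro bounded_Int disjI1 bounded_cball)
    show "K n \<noteq> {}" for n using approx[of n] by (auto simp: K_def dist_norm)
  qed blast
  have "(\<lambda>n::nat. M * (1 / Suc n)) \<longlonglongrightarrow> M * 0" by (intro tendsto_intros LIMSEQ_Suc[OF lim_1_over_n])
  then have "norm (x - \<iota> k) \<le> M * 0"
    using k by (intro LIMSEQ_le_const) (auto simp: K_def dist_norm)
  then show ?thesis by auto
qed

text \<open>All bounds come from \<open>l \<le> p\<close>: the competitor \<open>0\<close> in the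
  infimum makes \<open>l\<close> continuous, the competitor \<open>h\<close> at
  \<open>\<iota> h\<close> gives the bound by \<open>norm h\<close>, and \<open>l x = p x\<close> is
  large.\<close>

lemma exists_large_functional:
  fixes \<iota> :: "'h::{real_inner, complete_space} \<Rightarrow> 'e::real_normed_vector"
  assumes \<iota>: "bounded_linear \<iota>" and x: "x \<notin> range \<iota>"
  obtains l :: "'e \<Rightarrow>\<^sub>L real" where "\<And>h. \<bar>l (\<iota> h)\<bar> \<le> norm h" "M \<le> l x"
proof -
  interpret \<iota>: bounded_linear \<iota> by fact
  have "\<exists>n. \<forall>h. norm h \<le> M \<longrightarrow> M / Suc n < norm (x - \<iota> h)"
    using mem_range_if_bounded_approximations[OF \<iota>, of M x] x by (meson not_less)
  then obtain n where n: "\<And>h. norm h \<le> M \<Longrightarrow> M / Suc n < norm (x - \<iota> h)" by blast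
  \<comment> \<open>With this weight every competitor costs at least \<open>M\<close> at
    \<open>x\<close>: if \<open>norm h > M\<close> by the first summand, otherwise by the second,
    thanks to the choice of \<open>n\<close>.\<close>
  define b where "b = real (Suc n)"
  have b: "b > 0" by (simp add: b_def)
  define p where "p z = (INF h. norm h + b * norm (z - \<iota> h))" for z
  have bb: "bdd_below (range (\<lambda>h. norm h + b * norm (z - \<iota> h)))" for z
    using b by (intro bdd_belowI2[of _ 0]) simp
  have le: "p z \<le> norm h + b * norm (z - \<iota> h)" for z h
    unfolding p_def by (intro cINF_lower bb) simp
  have ge: "m \<le> p z" if "\<And>h. m \<le> norm h + b * norm (z - \<iota> h)" for m z
    unfolding p_def using that by (intro cINF_greatest) auto
  have "sublinear p"
  proof (rule sublinearI)
    fix y z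
    have "p (y + z) - (norm g + b * norm (z - \<iota> g)) \<le> norm h + b * norm (y - \<iota> h)" for g h
    proof -
      have "norm (y + z - \<iota> (h + g)) \<le> norm (y - \<iota> h) + norm (z - \<iota> g)"
        using norm_triangle_ineq[of "y - \<iota> h" "z - \<iota> g"] by (simp add: \<iota>.add algebra_simps)
      then have "b * norm (y + z - \<iota> (h + g)) \<le> b * norm (y - \<iota> h) + b * norm (z - \<iota> g)"
        using b by (simp flip: distrib_left)
      then show ?thesis using le[of "y + z" "h + g"] norm_triangle_ineq[of h g] by linarith
    qed
    then have "p (y + z) - (norm g + b * norm (z - \<iota> g)) \<le> p y" for g by (rule ge)
    then have "p (y + z) - p y \<le> norm g + b * norm (z - \<iota> g)" for g by (simp add: algebra_simps)
    then have "p (y + z) - p y \<le> p z" by (rule ge)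
    then show "p (y + z) \<le> p y + p z" by simp
  next
    fix c :: real and z assume c: "c > 0"
    have "p (c *\<^sub>R z) / c \<le> norm h + b * norm (z - \<iota> h)" for h
    proof -
      have "norm (c *\<^sub>R z - \<iota> (c *\<^sub>R h)) = c * norm (z - \<iota> h)"
        using c by (simp add: \<iota>.scaleR flip: scaleR_diff_right)
      then show ?thesis using le[of "c *\<^sub>R z" "c *\<^sub>R h"] c by (simp add: field_simps)
    qed
    then have "p (c *\<^sub>R z) / c \<le> p z" by (rule ge)
    then show "p (c *\<^sub>R z) \<le> c * p z" using c by (simp add: field_simps)
  qed
  then obtain l where l: "linear l" "\<And>z. l z \<le> p z" "l x = p x"
    using hahn_banach_sublinear[of p x] by blast
  have abs: "\<bar>l z\<bar> \<le> B" if "p z \<le> B" "p (- z) \<le> B" for z B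
    using that l(2)[of z] l(2)[of "- z"] linear_neg[OF l(1), of z] by linarith
  have "\<bar>l z\<bar> \<le> b * norm z" for z
    using le[of z 0] le[of "- z" 0] by (intro abs) (simp_all add: \<iota>.zero)
  then have "bounded_linear l"
    using l(1) by (intro bounded_linear_intro[of l b]) (simp_all add: linear_add linear_scale mult.commute)
  then have [simp]: "blinfun_apply (Blinfun l) = l" by (rule bounded_linear_Blinfun_apply)
  show thesis
  proof (rule that[of "Blinfun l"])
    show "\<bar>Blinfun l (\<iota> h)\<bar> \<le> norm h" for h
      using le[of "\<iota> h" h] le[of "- \<iota> h" "- h"] by (auto intro!: abs simp: \<iota>.neg)
    have "M \<le> norm h + b * norm (x - \<iota> h)" for h
    proof (cases "norm h \<le> M")
      case True
      then have "M < b * norm (x - \<iota> h)" using n[OF True] b by (simp add: b_def field_simps)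
      then show ?thesis using norm_ge_zero[of h] by linarith
    next
      case False
      moreover have "0 \<le> b * norm (x - \<iota> h)" using b by simp
      ultimately show ?thesis by linarith
    qed
    then show "M \<le> Blinfun l x" using l(3) by (auto intro: ge)
  qed
qed

text \<open>\<open>dual_to_H\<close> is a definite description, so the Riesz representation must
  first supply the vector it denotes; testing the bound at that vector gives
  \<open>norm h * norm h \<le> norm h\<close>.\<close>

lemma norm_dual_to_H_le:
  fixes \<iota> :: "'h::{real_inner, complete_space} \<Rightarrow> 'e::real_normed_vector"
  assumes \<iota>: "bounded_linear \<iota>" and l: "\<And>h. \<bar>blinfun_apply l (\<iota> h)\<bar> \<le> norm h"
  shows "norm (dual_to_H \<iota> l) \<le> 1"
proof -
  have "bounded_linear (\<lambda>h. l (\<iota> h))"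
    using bounded_linear_compose[OF blinfun.bounded_linear_right \<iota>] .
  then obtain h where h: "\<And>k. l (\<iota> k) = h \<bullet> k" using riesz_representation by blast
  have "dual_to_H \<iota> l = h"
    unfolding dual_to_H_def
  proof (rule the_equality)
    show "h' = h" if "\<forall>k. l (\<iota> k) = h' \<bullet> k" for h'
      using that h by (simp add: vector_eq_rdot)
  qed (simp add: h)
  moreover have "norm h * norm h \<le> norm h"
    using l[of h] h[of h] by (simp add: power2_norm_eq_inner flip: power2_eq_square)
  then have "norm h \<le> 1" by (cases "h = 0") simp_all
  ultimately show ?thesis by simp
qed

section \<open>The subspace \<open>E\<^sub>x\<close>\<close>

lemma continuous_on_Q_tilde: "continuous_on UNIV (Q_tilde \<iota> e \<sigma> n)"
  unfolding Q_tilde_def P_tilde_def by (cases "n = 0") (simp_all, intro continuous_intros)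

lemma linear_Q_tilde: "linear (Q_tilde \<iota> e \<sigma> n)"
  by (rule linearI)
    (simp_all add: Q_tilde_def P_tilde_def blinfun.add_right blinfun.scaleR_right scaleR_add_left
      sum.distrib scaleR_sum_right)

definition increment_term where
  "increment_term \<iota> e \<sigma> n z = 2 ^ n * (norm (Q_tilde \<iota> e \<sigma> (Suc n) z - Q_tilde \<iota> e \<sigma> n z))\<^sup>2"

definition functional_term :: "(nat \<Rightarrow> ('e::banach \<Rightarrow>\<^sub>L real)) \<Rightarrow> nat \<Rightarrow> 'e \<Rightarrow> real" where
  "functional_term e n z = 2 powr (- real (Suc n) / 2) * \<bar>e (Suc n) z\<bar>"

text \<open>Square and square root preserve finiteness, and a sum in \<open>[0, \<infinity>]\<close>
  is finite exactly if both summands are, so \<open>E_sub\<close> splits into two convergence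
  sets.\<close>

lemma E_sub_eq:
  "E_sub \<iota> e \<sigma> = {z. summable (\<lambda>n. increment_term \<iota> e \<sigma> n z)} \<inter> {z. summable (\<lambda>n. functional_term e n z)}"
proof -
  have "q_norm \<iota> e \<sigma> z < \<infinity> \<longleftrightarrow> q_squared \<iota> e \<sigma> z < \<top>" for z
    by (auto simp: q_norm_def less_top)
  also have "q_squared \<iota> e \<sigma> z < \<top> \<longleftrightarrow>
      (\<Sum>n. ennreal (increment_term \<iota> e \<sigma> n z)) < \<top> \<and> (\<Sum>n. ennreal (functional_term e n z)) < \<top>" for z
    by (simp add: q_squared_def increment_term_def functional_term_def power_less_top_ennreal)
  finally show ?thesis
    by (auto simp: E_sub_def suminf_ennreal_finite_iff increment_term_def functional_term_def)
qed

lemma E_sub_borel: "E_sub \<iota> e \<sigma> \<in> sets borel"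
  unfolding E_sub_eq increment_term_def functional_term_def
  by (intro sets.Int borel_summable_set continuous_intros continuous_on_Q_tilde) auto

lemma subspace_E_sub: "subspace (E_sub \<iota> e \<sigma>)"
  unfolding E_sub_eq
proof (intro subspace_inter subspace_summable_set)
  let ?D = "\<lambda>n z. Q_tilde \<iota> e \<sigma> (Suc n) z - Q_tilde \<iota> e \<sigma> n z"
  fix n y z c
  show "increment_term \<iota> e \<sigma> n (y + z) \<le> 2 * (increment_term \<iota> e \<sigma> n y + increment_term \<iota> e \<sigma> n z)"
  proof -
    have "?D n (y + z) = ?D n y + ?D n z" by (simp add: linear_add[OF linear_Q_tilde])
    then have "(norm (?D n (y + z)))\<^sup>2 \<le> (norm (?D n y) + norm (?D n z))\<^sup>2"
      by (intro power_mono) (simp_all add: norm_triangle_ineq)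
    also have "\<dots> \<le> 2 * ((norm (?D n y))\<^sup>2 + (norm (?D n z))\<^sup>2)"
      using sum_squares_bound[of "norm (?D n y)" "norm (?D n z)"] by (simp add: power2_sum)
    finally have "2 ^ n * (norm (?D n (y + z)))\<^sup>2 \<le> 2 ^ n * (2 * ((norm (?D n y))\<^sup>2 + (norm (?D n z))\<^sup>2))"
      by (intro mult_left_mono) auto
    then show ?thesis by (simp add: increment_term_def algebra_simps)
  qed
  have "?D n (c *\<^sub>R z) = c *\<^sub>R ?D n z"
    by (simp add: linear_scale[OF linear_Q_tilde] scaleR_diff_right)
  then show "increment_term \<iota> e \<sigma> n (c *\<^sub>R z) = c\<^sup>2 * increment_term \<iota> e \<sigma> n z"
    by (simp add: increment_term_def power_mult_distrib)
  show "functional_term e n (y + z) \<le> 2 * (functional_term e n y + functional_term e n z)"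
  proof -
    have "\<bar>e (Suc n) (y + z)\<bar> \<le> 2 * (\<bar>e (Suc n) y\<bar> + \<bar>e (Suc n) z\<bar>)"
      by (simp add: blinfun.add_right)
    then have "2 powr (- real (Suc n) / 2) * \<bar>e (Suc n) (y + z)\<bar>
        \<le> 2 powr (- real (Suc n) / 2) * (2 * (\<bar>e (Suc n) y\<bar> + \<bar>e (Suc n) z\<bar>))"
      by (intro mult_left_mono) auto
    then show ?thesis by (simp add: functional_term_def algebra_simps)
  qed
  show "functional_term e n (c *\<^sub>R z) = \<bar>c\<bar> * functional_term e n z"
    by (simp add: functional_term_def blinfun.scaleR_right abs_mult)
qed (simp_all add: increment_term_def functional_term_def linear_0[OF linear_Q_tilde])

text \<open>The weights are inverse to the lower bounds on the basis functionals at
  \<open>x\<close>, so no term of the second series falls below \<open>1\<close> there.\<close>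

lemma adapted_basis_notin_E_sub:
  assumes "adapted_basis \<iota> x e"
  shows "x \<notin> E_sub \<iota> e \<sigma>"
proof
  assume "x \<in> E_sub \<iota> e \<sigma>"
  then have "(\<lambda>n. functional_term e n x) \<longlonglongrightarrow> 0" by (simp add: E_sub_eq summable_LIMSEQ_zero)
  moreover have "1 \<le> functional_term e n x" for n
  proof -
    have "2 powr (real (Suc n) / 2) \<le> e (Suc n) x"
      using assms unfolding adapted_basis_def by (metis le_add1 plus_1_eq_Suc)
    then have "2 powr (- real (Suc n) / 2) * 2 powr (real (Suc n) / 2) \<le> functional_term e n x"
      unfolding functional_term_def by (intro mult_left_mono) auto
    moreover have "- real (Suc n) / 2 + real (Suc n) / 2 = 0" by linarith
    ultimately show ?thesis unfolding powr_add[symmetric] by simp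
  qed
  ultimately have "(1::real) \<le> 0" by (intro LIMSEQ_le_const) auto
  then show False by simp
qed

section \<open>Full measure of \<open>E_sub\<close>\<close>

lemma orthonormal_basis_norm:
  assumes "orthonormal_basis b" "n \<ge> 1"
  shows "norm (b n) = 1"
  using assms by (simp add: orthonormal_basis_def norm_eq_1)

text \<open>By the triangle inequality the increments are eventually at most
  \<open>2 / 2 ^ n\<close>; squaring beats the weight \<open>2 ^ n\<close> and leaves a geometric
  series.\<close>

lemma summable_increments:
  fixes Q :: "nat \<Rightarrow> 'a::real_normed_vector"
  assumes "\<forall>\<^sub>F n in sequentially. norm (z - Q n) \<le> 1 / 2 ^ n"
  shows "summable (\<lambda>n. 2 ^ n * (norm (Q (Suc n) - Q n))\<^sup>2)"
proof -
  obtain N where N: "\<And>n. n \<ge> N \<Longrightarrow> norm (z - Q n) \<le> 1 / 2 ^ n"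
    using assms by (auto simp: eventually_sequentially)
  show ?thesis
  proof (rule summable_comparison_test'[of "\<lambda>n. 4 * (1 / 2) ^ n" N])
    show "summable (\<lambda>n. 4 * (1 / 2 :: real) ^ n)" by (intro summable_mult summable_geometric) simp
    fix n assume n: "n \<ge> N"
    have "norm (Q (Suc n) - Q n) \<le> norm (z - Q n) + norm (z - Q (Suc n))"
      using norm_triangle_ineq4[of "z - Q n" "z - Q (Suc n)"] by simp
    also have "\<dots> \<le> 1 / 2 ^ n + 1 / 2 ^ Suc n" using n by (intro add_mono N) auto
    also have "\<dots> \<le> 2 / 2 ^ n" by (simp add: field_simps)
    finally have "(norm (Q (Suc n) - Q n))\<^sup>2 \<le> (2 / 2 ^ n)\<^sup>2" by (intro power_mono) auto
    then have "2 ^ n * (norm (Q (Suc n) - Q n))\<^sup>2 \<le> 2 ^ n * (2 / 2 ^ n)\<^sup>2" by simp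
    also have "\<dots> = 4 * (1 / 2) ^ n" by (simp add: power2_eq_square power_divide)
    finally show "norm (2 ^ n * (norm (Q (Suc n) - Q n))\<^sup>2) \<le> 4 * (1 / 2) ^ n" by simp
  qed
qed

lemma (in abstract_wiener_space) AE_E_sub:
  assumes basis: "adapted_basis \<iota> x e" and sub: "adapted_subsequence \<iota> \<mu> e \<sigma>"
  shows "AE z in \<mu>. z \<in> E_sub \<iota> e \<sigma>"
proof -
  have "AE z in \<mu>. summable (\<lambda>n. functional_term e n z)"
    unfolding functional_term_def
  proof (rule AE_summable_functionals)
    show "norm (dual_to_H \<iota> (e (Suc n))) \<le> 1" for n
      using basis orthonormal_basis_norm[of "\<lambda>n. dual_to_H \<iota> (e n)" "Suc n"] by (simp add: adapted_basis_def)
    \<comment> \<open>The weights form a geometric sequence of ratio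
      \<open>2 powr (- 1 / 2) < 1\<close>.\<close>
    have "2 powr (- real (Suc n) / 2) = (2 powr (- 1 / 2)) ^ Suc n" for n
      by (simp add: powr_realpow[symmetric] powr_powr diff_divide_distrib add_divide_distrib
          del: power_Suc)
    moreover have "summable (\<lambda>n. (2 powr (- 1 / 2 :: real)) ^ Suc n)"
      by (subst summable_Suc_iff) (simp add: summable_geometric_iff powr_less_one)
    ultimately show "summable (\<lambda>n. 2 powr (- real (Suc n) / 2))" by simp
  qed simp
  moreover have "AE z in \<mu>. summable (\<lambda>n. increment_term \<iota> e \<sigma> n z)"
  proof -
    \<comment> \<open>The shift to \<open>Suc n\<close> is made because the probability bounds start
      at index \<open>1\<close>. They are summable, so by Borel-Cantelli almost every point lies in
      only finitely many \<open>A n\<close>.\<close>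
    define A where "A n = {z. norm (z - Q_tilde \<iota> e \<sigma> (Suc n) z) > 1 / 2 ^ Suc n}" for n
    have "open (A n)" for n unfolding A_def
      by (intro open_Collect_less continuous_intros continuous_on_Q_tilde)
    then have [measurable]: "A n \<in> sets \<mu>" for n unfolding sets_borel by simp
    have "summable (\<lambda>n. measure \<mu> (A n))"
    proof (rule summable_comparison_test')
      show "summable (\<lambda>n. (1 / 2 :: real) ^ Suc n)"
        by (subst summable_Suc_iff) (simp add: summable_geometric)
      have "measure \<mu> (A n) \<le> 1 / 2 ^ Suc n" for n
        using sub unfolding adapted_subsequence_def A_def by auto
      then show "norm (measure \<mu> (A n)) \<le> (1 / 2) ^ Suc n" for n
        by (simp add: power_divide)
    qed
    then have "AE z in \<mu>. \<forall>\<^sub>F n in sequentially. z \<in> space \<mu> - A n"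
      by (intro borel_cantelli_AE1) (auto simp: emeasure_eq_measure)
    then show ?thesis
    proof eventually_elim
      case (elim z)
      then have "\<forall>\<^sub>F n in sequentially. norm (z - Q_tilde \<iota> e \<sigma> (Suc n) z) \<le> 1 / 2 ^ Suc n"
        by eventually_elim (auto simp: A_def)
      then have "\<forall>\<^sub>F n in sequentially. norm (z - Q_tilde \<iota> e \<sigma> n z) \<le> 1 / 2 ^ n"
        unfolding eventually_sequentially_Suc[of "\<lambda>n. norm (z - Q_tilde \<iota> e \<sigma> n z) \<le> 1 / 2 ^ n"] .
      then show ?case unfolding increment_term_def by (rule summable_increments)
    qed
  qed
  ultimately show ?thesis by eventually_elim (simp add: E_sub_eq)
qed

section \<open>A Borel subspace of full measure avoiding \<open>x\<close>, without a basis\<close>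

lemma (in abstract_wiener_space) exists_full_proper_subspace:
  assumes "x \<notin> range \<iota>"
  obtains V where "subspace V" "V \<in> sets borel" "AE w in \<mu>. w \<in> V" "x \<notin> V"
proof -
  have "\<exists>l :: 'e \<Rightarrow>\<^sub>L real. (\<forall>h. \<bar>l (\<iota> h)\<bar> \<le> norm h) \<and> 2 ^ n \<le> l x" for n :: nat
    using exists_large_functional[OF continuous_embedding assms] by metis
  then obtain l :: "nat \<Rightarrow> 'e \<Rightarrow>\<^sub>L real"
    where l: "\<And>n h. \<bar>l n (\<iota> h)\<bar> \<le> norm h" and lx: "\<And>n. 2 ^ n \<le> l n x"
    by metis
  \<comment> \<open>The weights \<open>(1 / 2) ^ n\<close> are summable, which gives full measure,
    yet cancel the growth \<open>2 ^ n\<close> at \<open>x\<close>, where the series therefore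
    diverges.\<close>
  define V where "V = {z. summable (\<lambda>n. (1 / 2) ^ n * \<bar>l n z\<bar>)}"
  show thesis
  proof (rule that)
    show "subspace V" unfolding V_def
    proof (rule subspace_summable_set)
      fix n y z c
      have "\<bar>l n (y + z)\<bar> \<le> 2 * (\<bar>l n y\<bar> + \<bar>l n z\<bar>)" by (simp add: blinfun.add_right)
      then have "(1 / 2) ^ n * \<bar>l n (y + z)\<bar> \<le> (1 / 2) ^ n * (2 * (\<bar>l n y\<bar> + \<bar>l n z\<bar>))"
        by (intro mult_left_mono) auto
      then show "(1 / 2) ^ n * \<bar>l n (y + z)\<bar> \<le> 2 * ((1 / 2) ^ n * \<bar>l n y\<bar> + (1 / 2) ^ n * \<bar>l n z\<bar>)"
        by (simp add: algebra_simps)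
      show "(1 / 2) ^ n * \<bar>l n (c *\<^sub>R z)\<bar> = \<bar>c\<bar> * ((1 / 2) ^ n * \<bar>l n z\<bar>)"
        by (simp add: blinfun.scaleR_right abs_mult)
    qed auto
    show "V \<in> sets borel" unfolding V_def
      by (intro borel_summable_set continuous_intros) auto
    have "norm (dual_to_H \<iota> (l n)) \<le> 1" for n
      using norm_dual_to_H_le[OF continuous_embedding l] .
    then have "AE z in \<mu>. summable (\<lambda>n. (1 / 2) ^ n * \<bar>l n z\<bar>)"
      by (intro AE_summable_functionals) (auto intro: summable_geometric)
    then show "AE w in \<mu>. w \<in> V" by (simp add: V_def)
    show "x \<notin> V"
    proof
      assume "x \<in> V"
      then have "(\<lambda>n. (1 / 2) ^ n * \<bar>l n x\<bar>) \<longlonglongrightarrow> 0" by (simp add: V_def summable_LIMSEQ_zero)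
      moreover have "1 \<le> (1 / 2) ^ n * \<bar>l n x\<bar>" for n
      proof -
        have "(1 / 2) ^ n * 2 ^ n \<le> (1 / 2) ^ n * \<bar>l n x\<bar>"
          using lx[of n] by (intro mult_left_mono) auto
        then show ?thesis by (simp add: power_divide)
      qed
      ultimately have "(1::real) \<le> 0" by (intro LIMSEQ_le_const) auto
      then show False by simp
    qed
  qed
qed

theorem mainTheorem3:
  fixes \<iota> :: "'h::{real_inner, complete_space} \<Rightarrow> 'e::banach"
    and \<mu> :: "'e measure"
    and x :: 'e
  assumes "abstract_wiener_space \<iota> \<mu>"
    and "x \<notin> range \<iota>"
  shows
    "(\<forall>e \<sigma>. adapted_basis \<iota> x e \<longrightarrow> adapted_subsequence \<iota> \<mu> e \<sigma> \<longrightarrow>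
       (let E\<^sub>x = E_sub \<iota> e \<sigma> in
          E\<^sub>x \<in> sets borel \<and> subspace E\<^sub>x \<and> equiv UNIV (diff_rel E\<^sub>x) \<and>
          (\<forall>\<tau>. class_representatives (diff_rel E\<^sub>x) \<tau> \<longrightarrow>
             uncountable \<tau> \<and>
             (\<Union>z\<in>\<tau>. translate E\<^sub>x z) = UNIV \<and>
             disjoint_family_on (translate E\<^sub>x) \<tau> \<and>
             (\<forall>z\<in>\<tau>. translate E\<^sub>x z \<in> sets borel \<and> brownian_invariant \<mu> (translate E\<^sub>x z)))))
     \<and>
     (\<exists>\<F> :: 'e set set. uncountable \<F> \<and> disjoint \<F> \<and> \<Union>\<F> = UNIV \<and>
        (\<forall>A\<in>\<F>. A \<in> sets borel \<and> brownian_invariant \<mu> A))"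
    (is "?P \<and> ?Q")
proof
  interpret abstract_wiener_space \<iota> \<mu> by fact
  note partition = translate_partition[OF prob_space_axioms sets_borel]
  show ?P
    unfolding Let_def
  proof (intro allI impI conjI)
    fix e \<sigma> \<tau> assume basis: "adapted_basis \<iota> x e" and sub: "adapted_subsequence \<iota> \<mu> e \<sigma>"
    show "E_sub \<iota> e \<sigma> \<in> sets borel" by (rule E_sub_borel)
    show "subspace (E_sub \<iota> e \<sigma>)" by (rule subspace_E_sub)
    show "equiv UNIV (diff_rel (E_sub \<iota> e \<sigma>))" by (rule equiv_diff_rel[OF subspace_E_sub])
    assume "class_representatives (diff_rel (E_sub \<iota> e \<sigma>)) \<tau>"
    note * = partition[OF subspace_E_sub E_sub_borel AE_E_sub[OF basis sub]
        adapted_basis_notin_E_sub[OF basis] this]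
    show "uncountable \<tau>" "(\<Union>z\<in>\<tau>. translate (E_sub \<iota> e \<sigma>) z) = UNIV"
      "disjoint_family_on (translate (E_sub \<iota> e \<sigma>)) \<tau>"
      "\<forall>z\<in>\<tau>. translate (E_sub \<iota> e \<sigma>) z \<in> sets borel \<and> brownian_invariant \<mu> (translate (E_sub \<iota> e \<sigma>) z)"
      by (fact *)+
  qed
  show ?Q
  proof -
    obtain V where V: "subspace V" "V \<in> sets borel" "AE w in \<mu>. w \<in> V" "x \<notin> V"
      using exists_full_proper_subspace[OF assms(2)] by blast
    obtain \<tau> where \<tau>: "class_representatives (diff_rel V) \<tau>"
      using exists_class_representatives[OF equiv_diff_rel[OF V(1)]] by blast
    note * = partition[OF V \<tau>]
    \<comment> \<open>Cosets are nonempty, so disjointness makes \<open>translate V\<close>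
      injective on \<open>\<tau>\<close>; this carries uncountability from the representatives to
      the family of sets.\<close>
    have "z \<in> translate V z" for z using subspace_0[OF V(1)] by (simp add: translate_iff)
    then have "inj_on (translate V) \<tau>"
      using *(3) unfolding inj_on_def disjoint_family_on_def by blast
    then have "uncountable (translate V ` \<tau>)" using *(1) countable_image_inj_on by blast
    moreover have "disjoint (translate V ` \<tau>)"
      using *(3) by (rule disjoint_family_on_disjoint_image)
    ultimately show ?thesis using *(2,4) by (intro exI[of _ "translate V ` \<tau>"]) auto
  qed
qed

end
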